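(* Let $\Gamma$ be a finitely generated group and let $X$, $Y$ be computable metric spaces. Let $X'\subset X$ be a recursively compact set and $\Gamma\curvearrowright X'$ be a computable action. Let $\Gamma\curvearrowright Y'$, with $Y' \subset Y$, be a topological factor of $\Gamma\curvearrowright X'$ by a computable function $f\colon X'\to Y'$. Then $Y'$ is a recursively compact set and $\Gamma\curvearrowright Y'$ is a computable group action.
   Context: A computable metric space is $(X,d,\mathcal{S})$ where $(X,d)$ is a separable metric space, $\mathcal{S}=\{s_i: i\ge 0\}$ is dense, and there is an algorithm (Turing machine) which on input $(i,j,n)$ outputs $r\in\mathbb{Q}$ with $|d(s_i,s_j)-r|\le 2^{-n}$. Basic balls are open balls centered at points of $\mathcal{S}$ with positive rational radius; fix a computable enumeration $(B_n)_{n\in\mathbb{N}}$ of them and put $U_I=\bigcup_{n\in I}B_n$ for $I\subset\mathbb{N}$. A compact set $K\subset X$ is recursively compact if there is an algorithm which, given a finite $I\subset\mathbb{N}$, halts if and only if $K\subset U_I$. For computable metric spaces $X,Y$ and $Z\subset X$, a map $f\colon Z\to Y$ is computable if there is an algorithm which, given $m$, enumerates a set $I_m$ with $f^{-1}(B^Y_m)=U_{I_m}\cap Z$, where $(B^Y_m)_m$ enumerates the basic balls of $Y$. An action of a finitely generated group $\Gamma$ by homeomorphisms on a recursively compact subset of a computable metric space is computable if for some (equivalently any) finite generating set $S$, for each $s\in S$ the map $x\mapsto sx$ is computable. A topological factor map is a continuous surjective $\Gamma$-equivariant map. *)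

theory Defs
  imports
    "HOL-Analysis.Analysis"
    "HOL-Algebra.Group_Action"
    "HOL-Algebra.Generated_Groups"
    "HOL-Library.Nat_Bijection"
    "HOL-Library.Countable"
begin

section \<open>Algorithms\<close>

text \<open>
  Algorithms are programs for Kleene's partial recursive functions, with a big-step semantics.
  Finite tuples of naturals are lists. \<open>Prec\<close> recurses on the first argument, and \<open>Mu\<close> minimises
  over the first argument, requiring all smaller values to converge. Ill-formed programs
  (arity mismatches) diverge.
\<close>

datatype recf =
    Zero
  | Succ
  | Proj nat
  | Comp recf "recf list"
  | Prec recf recf
  | Mu recf

inductive computes :: "recf \<Rightarrow> nat list \<Rightarrow> nat \<Rightarrow> bool" where
  zero: "computes Zero xs 0"
| succ: "computes Succ [x] (Suc x)"
| proj: "i < length xs \<Longrightarrow> computes (Proj i) xs (xs ! i)"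
| comp: "list_all2 (\<lambda>g y. computes g xs y) gs ys \<Longrightarrow> computes f ys z \<Longrightarrow>
    computes (Comp f gs) xs z"
| prec_0: "computes f xs y \<Longrightarrow> computes (Prec f g) (0 # xs) y"
| prec_Suc: "computes (Prec f g) (n # xs) y \<Longrightarrow> computes g (n # y # xs) z \<Longrightarrow>
    computes (Prec f g) (Suc n # xs) z"
| mu: "computes f (n # xs) 0 \<Longrightarrow> (\<forall>k<n. \<exists>y. computes f (k # xs) (Suc y)) \<Longrightarrow>
    computes (Mu f) xs n"

inductive_cases computes_ZeroE: "computes Zero xs y"
inductive_cases computes_SuccE: "computes Succ xs y"
inductive_cases computes_ProjE: "computes (Proj i) xs y"
inductive_cases computes_CompE: "computes (Comp f gs) xs y"
inductive_cases computes_Prec_0E: "computes (Prec f g) (0 # xs) y"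
inductive_cases computes_Prec_SucE: "computes (Prec f g) (Suc n # xs) y"
inductive_cases computes_MuE: "computes (Mu f) xs y"

lemma computes_deterministic:
  assumes "computes p xs y" "computes p xs z"
  shows "y = z"
  using assms
proof (induction arbitrary: z rule: computes.induct)
  case (comp xs gs ys f w)
  from comp.prems obtain ys' where
    ys': "list_all2 (\<lambda>g y. computes g xs y) gs ys'" "computes f ys' z"
    by (rule computes_CompE)
  have "ys = ys'"
    using comp.IH(1) ys'(1) by (auto simp: list_all2_conv_all_nth intro!: nth_equalityI)
  then show ?case using comp.IH(2) ys'(2) by blast
next
  case (prec_Suc f g n xs y w)
  from prec_Suc.prems obtain y' where
    "computes (Prec f g) (n # xs) y'" "computes g (n # y' # xs) z"
    by (rule computes_Prec_SucE)
  then show ?case using prec_Suc.IH by blast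
next
  case (mu f n xs)
  from mu.prems have z: "computes f (z # xs) 0" "\<forall>k<z. \<exists>y. computes f (k # xs) (Suc y)"
    by (auto elim: computes_MuE)
  show ?case
  proof (cases n z rule: linorder_cases)
    case less
    then show ?thesis using z(2) mu.IH(1) by fastforce
  next
    case greater
    then show ?thesis using z(1) mu.IH(2) by fastforce
  qed
qed (blast elim: computes_ZeroE computes_SuccE computes_ProjE computes_Prec_0E)+

definition halts_on :: "recf \<Rightarrow> nat list \<Rightarrow> bool" where
  "halts_on p xs \<longleftrightarrow> (\<exists>y. computes p xs y)"

text \<open>
  The set enumerated by \<open>p\<close> on input \<open>m\<close>: the outputs of \<open>p\<close> on \<open>(m, k)\<close>, for those \<open>k\<close> on which
  it halts. In particular the empty set can be enumerated.
\<close>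

definition enumerated :: "recf \<Rightarrow> nat \<Rightarrow> nat set" where
  "enumerated p m = {n. \<exists>k. computes p [m, k] n}"


section \<open>Computable metric spaces\<close>

text \<open>
  A computable metric space is a type of class \<^class>\<open>metric_space\<close> together with the sequence
  \<open>s\<close> of special points. Rational outputs are coded through \<^const>\<open>nat_to_rat_surj\<close>.
\<close>

definition computable_metric_space :: "(nat \<Rightarrow> 'a::metric_space) \<Rightarrow> bool" where
  "computable_metric_space s \<longleftrightarrow>
     closure (range s) = UNIV \<and>
     (\<exists>p. \<forall>i j n. \<exists>r. computes p [i, j, n] r \<and>
        \<bar>dist (s i) (s j) - real_of_rat (nat_to_rat_surj r)\<bar> \<le> 1 / 2 ^ n)"

text \<open>
  The computable enumeration of the basic balls is fixed as follows: the code of \<open>(i, a, b)\<close>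
  denotes the open ball with centre \<open>s i\<close> and radius \<open>(a + 1) / (b + 1)\<close>, so that every pair of a
  special point and a positive rational radius occurs.
\<close>

definition basic_ball :: "(nat \<Rightarrow> 'a::metric_space) \<Rightarrow> nat \<Rightarrow> 'a set" where
  "basic_ball s n =
     (let (i, c) = prod_decode n; (a, b) = prod_decode c
      in ball (s i) (real (Suc a) / real (Suc b)))"

definition basic_union :: "(nat \<Rightarrow> 'a::metric_space) \<Rightarrow> nat set \<Rightarrow> 'a set" where
  "basic_union s I = (\<Union>n\<in>I. basic_ball s n)"

text \<open>Finite sets of indices are input through their canonical code \<^const>\<open>set_encode\<close>.\<close>

definition recursively_compact :: "(nat \<Rightarrow> 'a::metric_space) \<Rightarrow> 'a set \<Rightarrow> bool" where
  "recursively_compact s K \<longleftrightarrow>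
     compact K \<and>
     (\<exists>p. \<forall>I. finite I \<longrightarrow> (halts_on p [set_encode I] \<longleftrightarrow> K \<subseteq> basic_union s I))"

definition computable_map ::
  "(nat \<Rightarrow> 'a::metric_space) \<Rightarrow> (nat \<Rightarrow> 'b::metric_space) \<Rightarrow> 'a set \<Rightarrow> ('a \<Rightarrow> 'b) \<Rightarrow> bool" where
  "computable_map s t Z f \<longleftrightarrow>
     (\<exists>p. \<forall>m. {x \<in> Z. f x \<in> basic_ball t m} = basic_union s (enumerated p m) \<inter> Z)"


section \<open>Group actions\<close>

definition finitely_generated_group :: "('g, 'r) monoid_scheme \<Rightarrow> bool" where
  "finitely_generated_group G \<longleftrightarrow>
     group G \<and> (\<exists>S. finite S \<and> S \<subseteq> carrier G \<and> generate G S = carrier G)"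

definition action_by_homeomorphisms ::
  "('g, 'r) monoid_scheme \<Rightarrow> 'a::topological_space set \<Rightarrow> ('g \<Rightarrow> 'a \<Rightarrow> 'a) \<Rightarrow> bool" where
  "action_by_homeomorphisms G E \<phi> \<longleftrightarrow>
     group_action G E \<phi> \<and> (\<forall>g\<in>carrier G. \<exists>h. homeomorphism E E (\<phi> g) h)"

definition computable_action ::
  "('g, 'r) monoid_scheme \<Rightarrow> (nat \<Rightarrow> 'a::metric_space) \<Rightarrow> 'a set \<Rightarrow> ('g \<Rightarrow> 'a \<Rightarrow> 'a) \<Rightarrow> bool" where
  "computable_action G s E \<phi> \<longleftrightarrow>
     action_by_homeomorphisms G E \<phi> \<and>
     (\<exists>S. finite S \<and> S \<subseteq> carrier G \<and> generate G S = carrier G \<and>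
        (\<forall>g\<in>S. computable_map s s E (\<phi> g)))"

definition topological_factor_map ::
  "('g, 'r) monoid_scheme \<Rightarrow> 'a::topological_space set \<Rightarrow> ('g \<Rightarrow> 'a \<Rightarrow> 'a) \<Rightarrow>
   'b::topological_space set \<Rightarrow> ('g \<Rightarrow> 'b \<Rightarrow> 'b) \<Rightarrow> ('a \<Rightarrow> 'b) \<Rightarrow> bool" where
  "topological_factor_map G E \<phi> F \<psi> f \<longleftrightarrow>
     continuous_on E f \<and> f ` E = F \<and>
     (\<forall>g\<in>carrier G. \<forall>x\<in>E. f (\<phi> g x) = \<psi> g (f x))"

end

theory Submission
  imports Defs
begin

text \<open>
  Since \<open>X'\<close> is recursively compact, it is semidecidable whether \<open>X'\<close> is covered by an effectively
  enumerated union of basic balls. Pulling a finite union of balls back along \<open>f\<close> gives such a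
  union, so \<open>Y'\<close> is recursively compact.

  A map \<open>g\<close> continuous on \<open>Y'\<close> is computable as soon as \<open>g \<circ> f\<close> is: for a closed ball \<open>C\<close> of
  \<open>Y\<close>, the inclusion \<open>C \<inter> Y' \<subseteq> g\<inverse>(B)\<close> says that \<open>X'\<close> is covered by \<open>(g \<circ> f)\<inverse>(B)\<close> and
  \<open>f\<inverse>(Y - C)\<close>. The complement of \<open>C\<close> is the union of the balls whose center has distance to the center
  of \<open>C\<close> larger than the sum of the radii, a semidecidable condition. So these \<open>C\<close> can be
  enumerated, and their interiors exhaust \<open>g\<inverse>(B)\<close> within \<open>Y'\<close>. For a generator acting on \<open>Y'\<close> by
  \<open>g\<close>, the map \<open>g \<circ> f\<close> is \<open>f\<close> after the action of the generator on \<open>X'\<close>.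
\<close>

section \<open>Computable functions and decidable predicates\<close>

text \<open>
  Arguments are the first \<open>n\<close> values of an environment \<open>e\<close>, so that a bound variable is pushed by
  shifting the environment, and the closure rules below are higher-order patterns.
\<close>

definition computable_fun :: "nat \<Rightarrow> ((nat \<Rightarrow> nat) \<Rightarrow> nat) \<Rightarrow> bool" where
  "computable_fun n F \<longleftrightarrow> (\<exists>p. \<forall>e. computes p (map e [0..<n]) (F e))"

definition decidable :: "nat \<Rightarrow> ((nat \<Rightarrow> nat) \<Rightarrow> bool) \<Rightarrow> bool" where
  "decidable n P \<longleftrightarrow> computable_fun n (\<lambda>e. of_bool (P e))"

text \<open>Projections of decidable relations: closure properties become bookkeeping on the witness
  \<open>w\<close>, with no dovetailing of programs. \<open>semidecidable_computes\<close> and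
  \<open>semidecidable_halts\<close> make the link with halting.\<close>

definition semidecidable :: "nat \<Rightarrow> ((nat \<Rightarrow> nat) \<Rightarrow> bool) \<Rightarrow> bool" where
  "semidecidable n P \<longleftrightarrow>
     (\<exists>R. decidable (Suc n) (\<lambda>e. R (e 0) (\<lambda>i. e (Suc i))) \<and> (\<forall>e. P e \<longleftrightarrow> (\<exists>w. R w e)))"

named_theorems computable_intros

section \<open>Arithmetic functions\<close>

lemma map_upt_Suc_conv: "map e [0..<Suc n] = e 0 # map (\<lambda>i. e (Suc i)) [0..<n]"
  by (simp del: upt_Suc add: upt_conv_Cons flip: map_Suc_upt)

lemma computable_fun_proj [computable_intros]: "i < n \<Longrightarrow> computable_fun n (\<lambda>e. e i)"
  unfolding computable_fun_def
proof (intro exI allI)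
  fix e :: "nat \<Rightarrow> nat"
  assume "i < n"
  then show "computes (Proj i) (map e [0..<n]) (e i)"
    using computes.proj[of i "map e [0..<n]"] by simp
qed

text \<open>A program sees only the first \<open>n\<close> values of the environment and its output
  is unique.\<close>

lemma computable_fun_cong:
  assumes "computable_fun n F" "\<And>i. i < n \<Longrightarrow> e i = d i"
  shows "F e = F d"
proof -
  have "map e [0..<n] = map d [0..<n]" using assms(2) by simp
  with assms(1) show ?thesis
    unfolding computable_fun_def by (metis computes_deterministic)
qed

lemma computable_fun_compose:
  assumes "computable_fun k F" "\<And>i. i < k \<Longrightarrow> computable_fun n (G i)"
  shows "computable_fun n (\<lambda>e. F (\<lambda>i. G i e))"
proof -
  obtain p where p: "\<And>e. computes p (map e [0..<k]) (F e)"
    using assms(1) by (auto simp: computable_fun_def)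
  obtain q where q: "\<And>i e. i < k \<Longrightarrow> computes (q i) (map e [0..<n]) (G i e)"
    using assms(2) unfolding computable_fun_def by metis
  have "computes (Comp p (map q [0..<k])) (map e [0..<n]) (F (\<lambda>i. G i e))" for e
    by (rule computes.comp[OF _ p]) (simp add: list_all2_conv_all_nth q)
  then show ?thesis by (auto simp: computable_fun_def)
qed

lemma computable_fun_compose1:
  assumes "computable_fun 1 (\<lambda>e. f (e 0))" "computable_fun n A"
  shows "computable_fun n (\<lambda>e. f (A e))"
  using computable_fun_compose[OF assms(1), of n "\<lambda>_. A"] assms(2) by simp

text \<open>Substitution in the shape that arises under binders, where the first argument is split
  off; \<open>case_nat A B\<close> is the argument family with \<open>A\<close> put in
  front.\<close>

lemma computable_fun_compose_Cons:
  assumes "computable_fun (Suc k) (\<lambda>e. F (e 0) (\<lambda>i. e (Suc i)))"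
    and "computable_fun n A" "\<And>i. i < k \<Longrightarrow> computable_fun n (B i)"
  shows "computable_fun n (\<lambda>e. F (A e) (\<lambda>i. B i e))"
proof -
  have "computable_fun n (case_nat A B i)" if "i < Suc k" for i
    using that assms(2,3) by (cases i) auto
  from computable_fun_compose[OF assms(1), of n "case_nat A B", OF this] show ?thesis by simp
qed

lemma computable_fun_shift: "computable_fun n A \<Longrightarrow> computable_fun (Suc n) (\<lambda>e. A (\<lambda>i. e (Suc i)))"
  by (erule computable_fun_compose) (simp add: computable_fun_proj)

lemma computable_fun_Suc [computable_intros]:
  assumes "computable_fun n A"
  shows "computable_fun n (\<lambda>e. Suc (A e))"
proof (rule computable_fun_compose1[OF _ assms])
  have "computes Succ (map e [0..<1]) (Suc (e 0))" for e
    using computes.succ[of "e 0"] by simp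
  then show "computable_fun 1 (\<lambda>e. Suc (e 0))"
    unfolding computable_fun_def by blast
qed

lemma computable_fun_const [computable_intros]: "computable_fun n (\<lambda>_. c)"
proof (induction c)
  case 0
  then show ?case using computes.zero by (auto simp: computable_fun_def)
qed (rule computable_fun_Suc)

text \<open>\<open>Prec\<close> provides the recursion with its counter as an additional first
  argument; \<open>C\<close> is substituted for it at the end.\<close>

lemma computable_fun_rec_nat:
  assumes "computable_fun n B" "computable_fun n C"
    and "computable_fun (Suc (Suc n)) (\<lambda>e. S (e 0) (e (Suc 0)) (\<lambda>i. e (Suc (Suc i))))"
  shows "computable_fun n (\<lambda>e. rec_nat (B e) (\<lambda>i r. S i r e) (C e))"
proof -
  obtain p where p: "\<And>e. computes p (map e [0..<n]) (B e)"
    using assms(1) by (auto simp: computable_fun_def)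
  obtain q where q: "\<And>e. computes q (map e [0..<Suc (Suc n)]) (S (e 0) (e (Suc 0)) (\<lambda>i. e (Suc (Suc i))))"
    using assms(3) unfolding computable_fun_def by blast
  have "computes (Prec p q) (c # map e [0..<n]) (rec_nat (B e) (\<lambda>i r. S i r e) c)" for c e
  proof (induction c)
    case 0
    show ?case using computes.prec_0[OF p] by simp
  next
    case (Suc c)
    have "computes q (c # r # map e [0..<n]) (S c r e)" for r
      using q[of "case_nat c (case_nat r e)"] by (simp add: map_upt_Suc_conv del: upt_Suc)
    then show ?case using computes.prec_Suc[OF Suc] by simp
  qed
  then have "computes (Prec p q) (map e [0..<Suc n]) (rec_nat (B (\<lambda>i. e (Suc i))) (\<lambda>i r. S i r (\<lambda>i. e (Suc i))) (e 0))" for e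
    by (simp add: map_upt_Suc_conv del: upt_Suc)
  then have "computable_fun (Suc n) (\<lambda>e. rec_nat (B (\<lambda>i. e (Suc i))) (\<lambda>i r. S i r (\<lambda>i. e (Suc i))) (e 0))"
    unfolding computable_fun_def by blast
  from computable_fun_compose_Cons[OF this assms(2), of "\<lambda>i e. e i"]
  show ?thesis by (simp add: computable_fun_proj)
qed

lemma computable_fun_add [computable_intros]:
  assumes "computable_fun n A" "computable_fun n B"
  shows "computable_fun n (\<lambda>e. A e + B e)"
proof -
  have eq: "a + b = rec_nat a (\<lambda>_ r. Suc r) b" for a b :: nat
    by (induction b) auto
  show ?thesis
    unfolding eq by (intro computable_fun_rec_nat computable_intros assms) simp
qed

lemma computable_fun_mult [computable_intros]:
  assumes "computable_fun n A" "computable_fun n B"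
  shows "computable_fun n (\<lambda>e. A e * B e)"
proof -
  have eq: "a * b = rec_nat 0 (\<lambda>_ r. r + a) b" for a b :: nat
    by (induction b) auto
  show ?thesis
    unfolding eq
    by (intro computable_fun_rec_nat computable_intros computable_fun_compose[OF assms(1)] assms(2)) auto
qed

lemma computable_fun_power [computable_intros]:
  assumes "computable_fun n A"
  shows "computable_fun n (\<lambda>e. c ^ A e)"
proof -
  have eq: "c ^ b = rec_nat 1 (\<lambda>_ r. c * r) b" for b
    by (induction b) auto
  show ?thesis
    unfolding eq by (intro computable_fun_rec_nat computable_intros assms) simp
qed

lemma computable_fun_diff [computable_intros]:
  assumes "computable_fun n A" "computable_fun n B"
  shows "computable_fun n (\<lambda>e. A e - B e)"
proof -
  \<comment> \<open>Truncated subtraction is iterated predecessor, and the predecessor is itself a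
    recursion that returns its counter.\<close>
  have "rec_nat 0 (\<lambda>i _. i) a = a - 1" for a :: nat
    by (cases a) auto
  then have eq: "a - b = rec_nat a (\<lambda>_ r. rec_nat 0 (\<lambda>i _. i) r) b" for a b :: nat
    by (induction b) auto
  show ?thesis
    unfolding eq by (intro computable_fun_rec_nat computable_intros assms) auto
qed

section \<open>Decidable predicates and bounded quantifiers\<close>

lemma decidable_compose:
  assumes "decidable k P" "\<And>i. i < k \<Longrightarrow> computable_fun n (G i)"
  shows "decidable n (\<lambda>e. P (\<lambda>i. G i e))"
  using computable_fun_compose[of k "\<lambda>e. of_bool (P e)"] assms by (simp add: decidable_def)

lemma decidable_compose_Cons:
  assumes "decidable (Suc k) (\<lambda>e. P (e 0) (\<lambda>i. e (Suc i)))"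
    and "computable_fun n A" "\<And>i. i < k \<Longrightarrow> computable_fun n (B i)"
  shows "decidable n (\<lambda>e. P (A e) (\<lambda>i. B i e))"
  using computable_fun_compose_Cons[of k "\<lambda>a e. of_bool (P a e)"] assms by (simp add: decidable_def)

lemma decidable_not [computable_intros]:
  assumes "decidable n P"
  shows "decidable n (\<lambda>e. \<not> P e)"
proof -
  have eq: "of_bool (\<not> b) = 1 - (of_bool b :: nat)" for b by simp
  show ?thesis
    unfolding decidable_def eq by (intro computable_intros assms[unfolded decidable_def])
qed

lemma decidable_and [computable_intros]:
  "decidable n P \<Longrightarrow> decidable n Q \<Longrightarrow> decidable n (\<lambda>e. P e \<and> Q e)"
  unfolding decidable_def of_bool_conj by (rule computable_fun_mult)

lemma decidable_or [computable_intros]: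
  "decidable n P \<Longrightarrow> decidable n Q \<Longrightarrow> decidable n (\<lambda>e. P e \<or> Q e)"
  using decidable_not[OF decidable_and[OF decidable_not decidable_not], of n P Q] by simp

lemma decidable_le [computable_intros]:
  assumes "computable_fun n A" "computable_fun n B"
  shows "decidable n (\<lambda>e. A e \<le> B e)"
proof -
  have eq: "of_bool (a \<le> b) = 1 - (a - b)" for a b :: nat by simp
  show ?thesis
    unfolding decidable_def eq by (intro computable_intros assms)
qed

lemma decidable_less [computable_intros]:
  assumes "computable_fun n A" "computable_fun n B"
  shows "decidable n (\<lambda>e. A e < B e)"
  unfolding less_eq_Suc_le by (intro computable_intros assms)

lemma decidable_eq [computable_intros]:
  fixes A B :: "(nat \<Rightarrow> nat) \<Rightarrow> nat"
  assumes "computable_fun n A" "computable_fun n B"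
  shows "decidable n (\<lambda>e. A e = B e)"
  unfolding order_eq_iff by (intro computable_intros assms)

lemma computable_fun_if [computable_intros]:
  assumes "decidable n P" "computable_fun n A" "computable_fun n B"
  shows "computable_fun n (\<lambda>e. if P e then A e else B e)"
proof -
  have eq: "(if P e then A e else B e) = of_bool (P e) * A e + (1 - of_bool (P e)) * B e" for e
    by simp
  show ?thesis
    unfolding eq by (intro computable_intros assms(2,3) assms(1)[unfolded decidable_def])
qed

lemma decidable_bex [computable_intros]:
  assumes "computable_fun n B" "decidable (Suc n) (\<lambda>e. P (e 0) (\<lambda>i. e (Suc i)))"
  shows "decidable n (\<lambda>e. \<exists>y<B e. P y e)"
proof -
  have eq: "of_bool (\<exists>y<b. P y e) = rec_nat 0 (\<lambda>i r. if P i e \<or> r \<noteq> 0 then 1 else 0) b" for b e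
  proof (induction b)
    case (Suc b)
    show ?case by (simp add: less_Suc_eq ex_disj_distrib conj_disj_distribR flip: Suc)
  qed simp
  have "decidable (Suc (Suc n)) (\<lambda>e. P (e 0) (\<lambda>i. e (Suc (Suc i))) \<or> e (Suc 0) \<noteq> 0)"
    by (auto intro!: computable_intros decidable_compose_Cons[OF assms(2)])
  from computable_fun_rec_nat[OF computable_fun_const assms(1)
      computable_fun_if[OF this computable_fun_const computable_fun_const]]
  show ?thesis unfolding decidable_def eq .
qed

lemma decidable_ball [computable_intros]:
  assumes "computable_fun n B" "decidable (Suc n) (\<lambda>e. P (e 0) (\<lambda>i. e (Suc i)))"
  shows "decidable n (\<lambda>e. \<forall>y<B e. P y e)"
  using decidable_not[OF decidable_bex[OF assms(1) decidable_not[OF assms(2)]]] by simp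

text \<open>The bound is a fixed number and nothing relates the programs for the various
  \<open>P i\<close>, so the conjunction is built by induction on \<open>k\<close> instead of inside
  one recursion.\<close>

lemma decidable_all_less:
  fixes k :: nat
  assumes "\<And>i. i < k \<Longrightarrow> decidable n (P i)"
  shows "decidable n (\<lambda>e. \<forall>i<k. P i e)"
  using assms
proof (induction k)
  case 0
  have "decidable n (\<lambda>e. (0::nat) = 0)" by (intro computable_intros)
  then show ?case by simp
next
  case (Suc k)
  have "decidable n (\<lambda>e. (\<forall>i<k. P i e) \<and> P k e)"
    by (intro computable_intros Suc) auto
  moreover have "(\<forall>i<Suc k. P i e) \<longleftrightarrow> (\<forall>i<k. P i e) \<and> P k e" for e
    by (auto simp: less_Suc_eq)
  ultimately show ?case by simp
qed

section \<open>Unbounded search and decoding\<close>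

text \<open>The tested program is total, so the demand of \<open>Mu\<close> that all smaller values
  converge is automatic. The negation is there because \<open>Mu\<close> looks for a zero.\<close>

lemma computes_Mu_iff:
  assumes "\<And>w. computes q (w # xs) (of_bool (\<not> R w))"
  shows "computes (Mu q) xs w \<longleftrightarrow> R w \<and> (\<forall>k<w. \<not> R k)"
proof
  assume "computes (Mu q) xs w"
  then have "computes q (w # xs) 0" "\<forall>k<w. \<exists>y. computes q (k # xs) (Suc y)"
    by (auto elim: computes_MuE)
  then show "R w \<and> (\<forall>k<w. \<not> R k)"
    using assms computes_deterministic by (metis (full_types) Zero_not_Suc of_bool_eq_0_iff)
next
  assume R: "R w \<and> (\<forall>k<w. \<not> R k)"
  then have "computes q (w # xs) 0" "\<And>k. k < w \<Longrightarrow> computes q (k # xs) (Suc 0)"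
    using assms by (metis of_bool_eq(1), metis One_nat_def of_bool_eq(2))
  then show "computes (Mu q) xs w" by (auto intro: computes.mu)
qed

lemma decidable_search:
  assumes "decidable (Suc n) (\<lambda>e. R (e 0) (\<lambda>i. e (Suc i)))"
  obtains q where "\<And>e w. computes q (map e [0..<n]) w \<longleftrightarrow> R w e \<and> (\<forall>k<w. \<not> R k e)"
proof -
  obtain q where q: "\<And>e. computes q (map e [0..<Suc n]) (of_bool (\<not> R (e 0) (\<lambda>i. e (Suc i))))"
    using decidable_not[OF assms] unfolding decidable_def computable_fun_def by blast
  have "computes q (w # map e [0..<n]) (of_bool (\<not> R w e))" for w e
    using q[of "case_nat w e"] by (simp add: map_upt_Suc_conv del: upt_Suc)
  then show ?thesis by (intro that[of "Mu q"] computes_Mu_iff)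
qed

text \<open>The value is found by searching for the unique point on the graph. This computes
  inverses of computable operations, such as halving and unpairing.\<close>

lemma computable_fun_graph:
  assumes "decidable (Suc n) (\<lambda>e. e 0 = F (\<lambda>i. e (Suc i)))"
  shows "computable_fun n F"
proof -
  obtain q where "\<And>e w. computes q (map e [0..<n]) w \<longleftrightarrow> w = F e \<and> (\<forall>k<w. k \<noteq> F e)"
    using decidable_search[of n "\<lambda>w e. w = F e"] assms by blast
  then show ?thesis unfolding computable_fun_def by auto
qed

lemma computable_fun_div2 [computable_intros]:
  assumes "computable_fun n A"
  shows "computable_fun n (\<lambda>e. A e div 2)"
proof (rule computable_fun_compose1[OF computable_fun_graph assms])
  have eq: "y = x div 2 \<longleftrightarrow> 2 * y = x \<or> Suc (2 * y) = x" for x y :: nat by auto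
  show "decidable (Suc 1) (\<lambda>e. e 0 = e (Suc 0) div 2)"
    unfolding eq by (intro computable_intros) auto
qed

lemma decidable_even [computable_intros]:
  assumes "computable_fun n A"
  shows "decidable n (\<lambda>e. even (A e))"
proof -
  have eq: "even a \<longleftrightarrow> 2 * (a div 2) = a" for a :: nat by presburger
  show ?thesis
    unfolding eq by (intro computable_intros assms)
qed

lemma decidable_mem_set_decode [computable_intros]:
  assumes "computable_fun n A" "computable_fun n B"
  shows "decidable n (\<lambda>e. A e \<in> set_decode (B e))"
proof -
  \<comment> \<open>Membership of \<open>a\<close> is the parity of \<open>b\<close> after halving
    \<open>a\<close> times.\<close>
  have eq: "b div 2 ^ a = rec_nat b (\<lambda>_ r. r div 2) a" for a b :: nat
    by (induction a) (simp_all add: div_mult2_eq mult.commute[of 2])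
  show ?thesis
    unfolding set_decode_def mem_Collect_eq eq
    by (intro computable_fun_rec_nat computable_intros assms) simp
qed

lemma computable_fun_prod_encode [computable_intros]:
  assumes "computable_fun n A" "computable_fun n B"
  shows "computable_fun n (\<lambda>e. prod_encode (A e, B e))"
  unfolding prod_encode_def triangle_def by (simp, intro computable_intros assms)

lemma computable_fun_prod_decode [computable_intros]:
  assumes "computable_fun n A"
  shows "computable_fun n (\<lambda>e. fst (prod_decode (A e)))"
    and "computable_fun n (\<lambda>e. snd (prod_decode (A e)))"
proof -
  \<comment> \<open>Both components are at most the code, so the graphs of the projections are
    decided by bounded search.\<close>
  have *: "a = fst (prod_decode z) \<longleftrightarrow> (\<exists>b<Suc z. prod_encode (a, b) = z)"
    "b = snd (prod_decode z) \<longleftrightarrow> (\<exists>a<Suc z. prod_encode (a, b) = z)" for a b z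
  proof -
    obtain c d where z: "z = prod_encode (c, d)"
      by (metis prod_decode_inverse surj_pair)
    show "a = fst (prod_decode z) \<longleftrightarrow> (\<exists>b<Suc z. prod_encode (a, b) = z)"
      using le_prod_encode_2[of d c] by (auto simp: z less_Suc_eq_le)
    show "b = snd (prod_decode z) \<longleftrightarrow> (\<exists>a<Suc z. prod_encode (a, b) = z)"
      using le_prod_encode_1[of c d] by (auto simp: z less_Suc_eq_le)
  qed
  have "computable_fun 1 (\<lambda>e. fst (prod_decode (e 0)))" "computable_fun 1 (\<lambda>e. snd (prod_decode (e 0)))"
    by (rule computable_fun_graph, unfold *, intro computable_intros; simp)+
  from this[THEN computable_fun_compose1, OF assms]
  show "computable_fun n (\<lambda>e. fst (prod_decode (A e)))" "computable_fun n (\<lambda>e. snd (prod_decode (A e)))" .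
qed

section \<open>Semidecidable predicates\<close>

lemma semidecidable_decidable:
  assumes "decidable n P"
  shows "semidecidable n P"
proof -
  have "decidable (Suc n) (\<lambda>e. P (\<lambda>i. e (Suc i)))"
    by (intro decidable_compose[OF assms] computable_intros) simp
  then show ?thesis
    unfolding semidecidable_def by (intro exI[of _ "\<lambda>_. P"]) simp
qed

lemma semidecidable_compose:
  assumes "semidecidable k P" "\<And>i. i < k \<Longrightarrow> computable_fun n (G i)"
  shows "semidecidable n (\<lambda>e. P (\<lambda>i. G i e))"
proof -
  obtain R where R: "decidable (Suc k) (\<lambda>e. R (e 0) (\<lambda>i. e (Suc i)))" "\<And>e. P e \<longleftrightarrow> (\<exists>w. R w e)"
    using assms(1) unfolding semidecidable_def by blast
  have "decidable (Suc n) (\<lambda>e. R (e 0) (\<lambda>i. G i (\<lambda>i. e (Suc i))))"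
    by (intro decidable_compose_Cons[OF R(1)] computable_fun_compose[OF assms(2)] computable_intros) auto
  then show ?thesis
    unfolding semidecidable_def R(2) by (intro exI[of _ "\<lambda>w e. R w (\<lambda>i. G i e)"]) simp
qed

lemma semidecidable_compose_Cons:
  assumes "semidecidable (Suc k) (\<lambda>e. P (e 0) (\<lambda>i. e (Suc i)))"
    and "computable_fun n A" "\<And>i. i < k \<Longrightarrow> computable_fun n (B i)"
  shows "semidecidable n (\<lambda>e. P (A e) (\<lambda>i. B i e))"
proof -
  have "semidecidable n (\<lambda>e. (\<lambda>e. P (e 0) (\<lambda>i. e (Suc i))) (\<lambda>i. case_nat A B i e))"
    by (rule semidecidable_compose[OF assms(1)]) (use assms in \<open>auto simp: less_Suc_eq_0_disj\<close>)
  then show ?thesis by simp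
qed

lemma semidecidable_disj [computable_intros]:
  assumes "semidecidable n P" "semidecidable n Q"
  shows "semidecidable n (\<lambda>e. P e \<or> Q e)"
proof -
  obtain R S where RS:
    "decidable (Suc n) (\<lambda>e. R (e 0) (\<lambda>i. e (Suc i)))" "\<And>e. P e \<longleftrightarrow> (\<exists>w. R w e)"
    "decidable (Suc n) (\<lambda>e. S (e 0) (\<lambda>i. e (Suc i)))" "\<And>e. Q e \<longleftrightarrow> (\<exists>w. S w e)"
    using assms unfolding semidecidable_def by blast
  then have "decidable (Suc n) (\<lambda>e. R (e 0) (\<lambda>i. e (Suc i)) \<or> S (e 0) (\<lambda>i. e (Suc i)))"
    by (intro computable_intros)
  then show ?thesis
    unfolding semidecidable_def RS(2,4) by (intro exI[of _ "\<lambda>w e. R w e \<or> S w e"]) blast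
qed

text \<open>A single number \<open>w\<close> bounds both the value and its witness, which merges the
  two existential quantifiers into one and leaves bounded, hence decidable, ones.\<close>

lemma semidecidable_ex [computable_intros]:
  assumes "semidecidable (Suc n) (\<lambda>e. P (e 0) (\<lambda>i. e (Suc i)))"
  shows "semidecidable n (\<lambda>e. \<exists>y. P y e)"
proof -
  obtain R where R: "decidable (Suc (Suc n)) (\<lambda>e. R (e 0) (\<lambda>i. e (Suc i)))"
      "\<And>e. P (e 0) (\<lambda>i. e (Suc i)) \<longleftrightarrow> (\<exists>w. R w e)"
    using assms unfolding semidecidable_def by blast
  have "decidable (Suc n) (\<lambda>e. \<exists>y<e 0. \<exists>u<e 0. R u (case_nat y (\<lambda>i. e (Suc i))))"
    by (intro computable_intros decidable_compose_Cons[OF R(1)])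
       (auto simp: computable_fun_proj less_Suc_eq_0_disj)
  moreover have "(\<exists>y. P y e) \<longleftrightarrow> (\<exists>w. \<exists>y<w. \<exists>u<w. R u (case_nat y e))" for e
  proof -
    have "P y e \<longleftrightarrow> (\<exists>u. R u (case_nat y e))" for y
      using R(2)[of "case_nat y e"] by simp
    moreover have "\<exists>w. y < w \<and> u < w" for y u :: nat
      by (meson less_Suc_eq_le max.cobounded1 max.cobounded2)
    ultimately show ?thesis by meson
  qed
  ultimately show ?thesis
    unfolding semidecidable_def by (intro exI[of _ "\<lambda>w e. \<exists>y<w. \<exists>u<w. R u (case_nat y e)"]) simp
qed

text \<open>Finitely many witnesses have a common bound, for instance the successor of their
  sum.\<close>

lemma semidecidable_ball [computable_intros]:
  assumes "computable_fun n B" "semidecidable (Suc n) (\<lambda>e. P (e 0) (\<lambda>i. e (Suc i)))"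
  shows "semidecidable n (\<lambda>e. \<forall>y<B e. P y e)"
proof -
  obtain R where R: "decidable (Suc (Suc n)) (\<lambda>e. R (e 0) (\<lambda>i. e (Suc i)))"
      "\<And>e. P (e 0) (\<lambda>i. e (Suc i)) \<longleftrightarrow> (\<exists>w. R w e)"
    using assms(2) unfolding semidecidable_def by blast
  have "decidable (Suc n) (\<lambda>e. \<forall>y<B (\<lambda>i. e (Suc i)). \<exists>u<e 0. R u (case_nat y (\<lambda>i. e (Suc i))))"
    by (intro computable_intros decidable_compose_Cons[OF R(1)] computable_fun_compose[OF assms(1)])
       (auto simp: computable_fun_proj less_Suc_eq_0_disj)
  moreover have "(\<forall>y<b. P y e) \<longleftrightarrow> (\<exists>w. \<forall>y<b. \<exists>u<w. R u (case_nat y e))" for e b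
  proof -
    have P: "P y e \<longleftrightarrow> (\<exists>u. R u (case_nat y e))" for y
      using R(2)[of "case_nat y e"] by simp
    show ?thesis
    proof
      assume "\<forall>y<b. P y e"
      then obtain u where u: "\<And>y. y < b \<Longrightarrow> R (u y) (case_nat y e)"
        unfolding P by metis
      have "u y < Suc (\<Sum>i<b. u i)" if "y < b" for y
        using that by (simp add: less_Suc_eq_le member_le_sum)
      with u show "\<exists>w. \<forall>y<b. \<exists>u<w. R u (case_nat y e)" by blast
    qed (use P in blast)
  qed
  ultimately show ?thesis
    unfolding semidecidable_def
    by (intro exI[of _ "\<lambda>w e. \<forall>y<B e. \<exists>u<w. R u (case_nat y e)"]) simp
qed

lemma semidecidable_conj [computable_intros]:
  assumes "semidecidable n P" "semidecidable n Q"
  shows "semidecidable n (\<lambda>e. P e \<and> Q e)"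
proof -
  obtain R S where RS:
    "decidable (Suc n) (\<lambda>e. R (e 0) (\<lambda>i. e (Suc i)))" "\<And>e. P e \<longleftrightarrow> (\<exists>w. R w e)"
    "decidable (Suc n) (\<lambda>e. S (e 0) (\<lambda>i. e (Suc i)))" "\<And>e. Q e \<longleftrightarrow> (\<exists>w. S w e)"
    using assms unfolding semidecidable_def by blast
  \<comment> \<open>The witnesses of the two conjuncts are unrelated, so each gets a variable of its
    own.\<close>
  have "decidable (Suc (Suc n)) (\<lambda>e. R (e 0) (\<lambda>i. e (Suc (Suc i))) \<and> S (e (Suc 0)) (\<lambda>i. e (Suc (Suc i))))"
    by (intro computable_intros decidable_compose_Cons[OF RS(1)] decidable_compose_Cons[OF RS(3)]) auto
  then have "semidecidable n (\<lambda>e. \<exists>v w. R w e \<and> S v e)"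
    by (rule semidecidable_ex[OF semidecidable_ex[OF semidecidable_decidable]])
  then show ?thesis by (simp add: RS(2,4))
qed

section \<open>Programs from semidecidable predicates\<close>

lemma semidecidable_halts:
  assumes "semidecidable 1 (\<lambda>e. P (e 0))"
  shows "\<exists>p. \<forall>x. halts_on p [x] \<longleftrightarrow> P x"
proof -
  obtain R where R: "decidable (Suc 1) (\<lambda>e. R (e 0) (\<lambda>i. e (Suc i)))" "\<And>e. P (e 0) \<longleftrightarrow> (\<exists>w. R w e)"
    using assms unfolding semidecidable_def by blast
  obtain p where p: "\<And>e w. computes p (map e [0..<1]) w \<longleftrightarrow> R w e \<and> (\<forall>k<w. \<not> R k e)"
    using decidable_search[OF R(1)] by blast
  have "halts_on p [x] \<longleftrightarrow> P x" for x
    using p[of "\<lambda>_. x"] R(2)[of "\<lambda>_. x"] exists_least_iff[of "\<lambda>w. R w (\<lambda>_. x)"]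
    by (simp add: halts_on_def)
  then show ?thesis by blast
qed

text \<open>The second input serves as the candidate: on \<open>(m, k)\<close> the program searches
  for a witness of \<open>Q m k\<close> and, if it finds one, outputs \<open>k\<close>.\<close>

lemma semidecidable_enumerated:
  assumes "semidecidable 2 (\<lambda>e. Q (e 0) (e 1))"
  shows "\<exists>p. \<forall>m. enumerated p m = {n. Q m n}"
proof -
  obtain R where R: "decidable (Suc 2) (\<lambda>e. R (e 0) (\<lambda>i. e (Suc i)))" "\<And>e. Q (e 0) (e 1) \<longleftrightarrow> (\<exists>w. R w e)"
    using assms unfolding semidecidable_def by blast
  obtain p where p: "\<And>e w. computes p (map e [0..<2]) w \<longleftrightarrow> R w e \<and> (\<forall>k<w. \<not> R k e)"
    using decidable_search[OF R(1)] by blast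
  have halts: "(\<exists>w. computes p [m, n] w) \<longleftrightarrow> Q m n" for m n
    using p[of "case_nat m (\<lambda>_. n)"] R(2)[of "case_nat m (\<lambda>_. n)"]
      exists_least_iff[of "\<lambda>w. R w (case_nat m (\<lambda>_. n))"]
    by (simp add: upt_rec numeral_2_eq_2)
  \<comment> \<open>\<open>Comp\<close> evaluates all inner programs, so the outer projection drops
    the witness found by \<open>p\<close> but keeps the condition that \<open>p\<close>
    halts.\<close>
  have "computes (Comp (Proj 1) [p, Proj 1]) [m, k] n \<longleftrightarrow> k = n \<and> Q m n" for m n k
  proof
    assume "computes (Comp (Proj 1) [p, Proj 1]) [m, k] n"
    then show "k = n \<and> Q m n"
      unfolding halts[symmetric]
      by (elim computes_CompE) (auto elim!: computes_ProjE simp: list_all2_Cons1)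
  next
    assume "k = n \<and> Q m n"
    then obtain w where "computes p [m, k] w" "k = n" using halts by blast
    then show "computes (Comp (Proj 1) [p, Proj 1]) [m, k] n"
      using computes.proj[of 1 "[m, k]"] computes.proj[of 1 "[w, k]"]
      by (intro computes.comp[of _ _ "[w, k]"]) simp_all
  qed
  then have "enumerated (Comp (Proj 1) [p, Proj 1]) m = {n. Q m n}" for m
    unfolding enumerated_def by blast
  then show ?thesis by blast
qed

section \<open>Semidecidability of convergence\<close>

text \<open>Soundness holds for every \<open>w\<close>, completeness for all large \<open>w\<close>:
  asking for eventual and not just occasional success lets finitely many approximations succeed at a
  common \<open>w\<close>, without any monotonicity.\<close>

definition approximates :: "(nat \<Rightarrow> nat) \<Rightarrow> (nat \<Rightarrow> bool) \<Rightarrow> bool" where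
  "approximates E C \<longleftrightarrow>
     (\<forall>w y. E w = Suc y \<longrightarrow> C y) \<and> (\<forall>y. C y \<longrightarrow> eventually (\<lambda>w. E w = Suc y) sequentially)"

lemma approximatesI:
  assumes "\<And>w y. E w = Suc y \<Longrightarrow> C y" "\<And>y. C y \<Longrightarrow> eventually (\<lambda>w. E w = Suc y) sequentially"
  shows "approximates E C"
  using assms by (auto simp: approximates_def)

lemma approximatesD:
  assumes "approximates E C"
  shows "E w = Suc y \<Longrightarrow> C y" "C y \<Longrightarrow> eventually (\<lambda>w. E w = Suc y) sequentially"
  using assms by (auto simp: approximates_def)

text \<open>
  \<open>E w\<close> is \<open>p\<close> run with fuel \<open>w\<close>: a total computable function with value \<open>Suc y\<close> once the output
  \<open>y\<close> was found and \<open>0\<close> if the fuel did not suffice. Only unbounded search consumes fuel. This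
  replaces coded computation histories by a recursion over the syntax of \<open>p\<close>.
\<close>

definition fueled :: "recf \<Rightarrow> nat \<Rightarrow> (nat \<Rightarrow> (nat \<Rightarrow> nat) \<Rightarrow> nat) \<Rightarrow> bool" where
  "fueled p n E \<longleftrightarrow>
     computable_fun (Suc n) (\<lambda>e. E (e 0) (\<lambda>i. e (Suc i))) \<and>
     (\<forall>e. approximates (\<lambda>w. E w e) (computes p (map e [0..<n])))"

lemma fueled_total:
  assumes "computable_fun n F" "\<And>e y. computes p (map e [0..<n]) y \<longleftrightarrow> y = F e"
  shows "fueled p n (\<lambda>_ e. Suc (F e))"
  unfolding fueled_def approximates_def
  by (auto intro!: computable_intros computable_fun_compose[OF assms(1)] simp: assms(2))

lemma fueled_diverging:
  assumes "\<And>e y. \<not> computes p (map e [0..<n]) y"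
  shows "fueled p n (\<lambda>_ _. 0)"
  unfolding fueled_def approximates_def by (auto intro!: computable_intros simp: assms)

text \<open>All components share the fuel. As there are finitely many, a large fuel suffices for all
  of them and for \<open>f\<close>; the \<open>- 1\<close> turns a success \<open>Suc y\<close> back
  into \<open>y\<close>.\<close>

lemma fueled_Comp:
  assumes "fueled f (length gs) F" "\<And>i. i < length gs \<Longrightarrow> fueled (gs ! i) n (G i)"
  shows "fueled (Comp f gs) n
    (\<lambda>w e. if \<forall>i<length gs. G i w e \<noteq> 0 then F w (\<lambda>i. G i w e - 1) else 0)"
  unfolding fueled_def
proof (intro conjI allI)
  have F: "computable_fun (Suc (length gs)) (\<lambda>e. F (e 0) (\<lambda>i. e (Suc i)))"
    using assms(1) by (simp add: fueled_def)
  have G: "computable_fun (Suc n) (\<lambda>e. G i (e 0) (\<lambda>i. e (Suc i)))" if "i < length gs" for i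
    using assms(2)[OF that] by (simp add: fueled_def)
  show "computable_fun (Suc n) (\<lambda>e. if \<forall>i<length gs. G i (e 0) (\<lambda>i. e (Suc i)) \<noteq> 0
      then F (e 0) (\<lambda>i. G i (e 0) (\<lambda>i. e (Suc i)) - 1) else 0)"
    by (intro computable_fun_if decidable_all_less decidable_not decidable_eq computable_fun_diff
      computable_fun_const computable_fun_compose_Cons[OF F] computable_fun_proj G) auto
next
  fix e :: "nat \<Rightarrow> nat"
  let ?xs = "map e [0..<n]"
  have F: "approximates (\<lambda>w. F w d) (computes f (map d [0..<length gs]))" for d
    using assms(1) by (simp add: fueled_def)
  have G: "approximates (\<lambda>w. G i w e) (computes (gs ! i) ?xs)" if "i < length gs" for i
    using assms(2)[OF that] by (simp add: fueled_def)
  show "approximates (\<lambda>w. if \<forall>i<length gs. G i w e \<noteq> 0 then F w (\<lambda>i. G i w e - 1) else 0)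
      (computes (Comp f gs) ?xs)"
  proof (rule approximatesI)
    fix w z
    assume *: "(if \<forall>i<length gs. G i w e \<noteq> 0 then F w (\<lambda>i. G i w e - 1) else 0) = Suc z"
    then have "computes (gs ! i) ?xs (G i w e - 1)" if "i < length gs" for i
      using that approximatesD(1)[OF G[OF that], of w "G i w e - 1"] by (auto split: if_splits)
    moreover have "computes f (map (\<lambda>i. G i w e - 1) [0..<length gs]) z"
      using * approximatesD(1)[OF F] by (auto split: if_splits)
    ultimately show "computes (Comp f gs) ?xs z"
      by (intro computes.comp) (auto simp: list_all2_conv_all_nth)
  next
    fix z
    assume "computes (Comp f gs) ?xs z"
    then obtain ys where ys: "list_all2 (\<lambda>g. computes g ?xs) gs ys" "computes f ys z"
      by (auto elim: computes_CompE)
    define d where "d i = ys ! i" for i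
    have len: "length ys = length gs"
      using ys(1) by (simp add: list_all2_lengthD)
    then have "computes f (map d [0..<length gs]) z"
      using ys(2) map_nth[of ys] by (simp add: d_def[abs_def])
    then have "eventually (\<lambda>w. F w d = Suc z) sequentially"
      by (rule approximatesD[OF F])
    moreover have "eventually (\<lambda>w. \<forall>i\<in>{..<length gs}. G i w e = Suc (d i)) sequentially"
      using ys(1) approximatesD(2)[OF G] by (auto simp: eventually_ball_finite_distrib list_all2_conv_all_nth d_def)
    ultimately show "eventually (\<lambda>w. (if \<forall>i<length gs. G i w e \<noteq> 0 then F w (\<lambda>i. G i w e - 1) else 0) = Suc z) sequentially"
    proof eventually_elim
      case (elim w)
      \<comment> \<open>The two environments need to agree only at the arguments that
        \<open>F\<close> reads, which are the fuel and the first \<open>length gs\<close>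
        values.\<close>
      then have "case_nat w (\<lambda>i. G i w e - 1) i = case_nat w d i" if "i < Suc (length gs)" for i
        using that by (cases i) auto
      from computable_fun_cong[OF assms(1)[unfolded fueled_def, THEN conjunct1],
          of "case_nat w (\<lambda>i. G i w e - 1)" "case_nat w d", OF this]
      have "F w (\<lambda>i. G i w e - 1) = F w d" by simp
      with elim show ?case by simp
    qed
  qed
qed

text \<open>Once a stage runs out of fuel, the value \<open>0\<close> is passed on through all later
  stages.\<close>

lemma fueled_Prec:
  assumes "fueled f n F" "fueled g (Suc (Suc n)) G"
  shows "fueled (Prec f g) (Suc n)
    (\<lambda>w e. rec_nat (F w (\<lambda>i. e (Suc i)))
       (\<lambda>i r. if r = 0 then 0 else G w (case_nat i (case_nat (r - 1) (\<lambda>i. e (Suc i))))) (e 0))"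
  unfolding fueled_def
proof (intro conjI allI)
  have F: "computable_fun (Suc n) (\<lambda>e. F (e 0) (\<lambda>i. e (Suc i)))"
    and G: "computable_fun (Suc (Suc (Suc n))) (\<lambda>e. G (e 0) (\<lambda>i. e (Suc i)))"
    using assms by (simp_all add: fueled_def)
  \<comment> \<open>Stage number and value so far are pushed in front of fuel and counter, hence the
    parameters are shifted by four.\<close>
  have "computable_fun (Suc (Suc (Suc (Suc n)))) (\<lambda>e. case_nat (e 0) (case_nat (e (Suc 0) - 1) (\<lambda>i. e (Suc (Suc (Suc (Suc i)))))) i)"
    if "i < Suc (Suc n)" for i
    using that by (auto simp: less_Suc_eq_0_disj intro!: computable_fun_diff computable_fun_proj computable_fun_const)
  note G = computable_fun_compose_Cons[OF G _ this]
  show "computable_fun (Suc (Suc n)) (\<lambda>e. rec_nat (F (e 0) (\<lambda>i. e (Suc (Suc i))))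
       (\<lambda>i r. if r = 0 then 0 else G (e 0) (case_nat i (case_nat (r - 1) (\<lambda>i. e (Suc (Suc i)))))) (e (Suc 0)))"
    by (intro computable_fun_rec_nat computable_fun_if decidable_eq computable_fun_const computable_fun_proj
          computable_fun_compose_Cons[OF F] G) auto
next
  fix e :: "nat \<Rightarrow> nat"
  let ?xs = "map (\<lambda>i. e (Suc i)) [0..<n]"
  define E where "E w c = rec_nat (F w (\<lambda>i. e (Suc i)))
       (\<lambda>i r. if r = 0 then 0 else G w (case_nat i (case_nat (r - 1) (\<lambda>i. e (Suc i))))) c" for w c
  have F: "approximates (\<lambda>w. F w (\<lambda>i. e (Suc i))) (computes f ?xs)"
    using assms(1) by (simp add: fueled_def)
  have G: "approximates (\<lambda>w. G w (case_nat i (case_nat r (\<lambda>i. e (Suc i))))) (computes g (i # r # ?xs))" for i r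
    using assms(2)[unfolded fueled_def, THEN conjunct2, rule_format, of "case_nat i (case_nat r (\<lambda>i. e (Suc i)))"]
    by (simp add: map_upt_Suc_conv del: upt_Suc)
  have "approximates (\<lambda>w. E w c) (computes (Prec f g) (c # ?xs))" for c
  proof (induction c)
    case 0
    show ?case
      using approximatesD[OF F]
      by (auto intro!: approximatesI computes.prec_0 simp: E_def elim: computes_Prec_0E)
  next
    case (Suc c)
    show ?case
    proof (rule approximatesI)
      fix w z
      assume "E w (Suc c) = Suc z"
      then obtain y where "E w c = Suc y" "G w (case_nat c (case_nat y (\<lambda>i. e (Suc i)))) = Suc z"
        by (cases "E w c") (auto simp: E_def)
      then show "computes (Prec f g) (Suc c # ?xs) z"
        using approximatesD(1)[OF Suc.IH] approximatesD(1)[OF G] by (blast intro: computes.prec_Suc)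
    next
      fix z
      assume "computes (Prec f g) (Suc c # ?xs) z"
      then obtain y where "computes (Prec f g) (c # ?xs) y" "computes g (c # y # ?xs) z"
        by (elim computes_Prec_SucE)
      from approximatesD(2)[OF Suc.IH this(1)] approximatesD(2)[OF G this(2)]
      show "eventually (\<lambda>w. E w (Suc c) = Suc z) sequentially"
        by eventually_elim (simp add: E_def)
    qed
  qed
  then show "approximates (\<lambda>w. rec_nat (F w (\<lambda>i. e (Suc i)))
       (\<lambda>i r. if r = 0 then 0 else G w (case_nat i (case_nat (r - 1) (\<lambda>i. e (Suc i))))) (e 0))
     (computes (Prec f g) (map e [0..<Suc n]))"
    unfolding E_def by (simp add: map_upt_Suc_conv del: upt_Suc)
qed

text \<open>
  The recursion scans the arguments below the fuel. Its value is \<open>0\<close> while the search goes on,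
  \<open>1\<close> once the fuel ran out in some evaluation, and \<open>k + 2\<close> once the zero \<open>k\<close> was found.
\<close>

lemma fueled_Mu:
  assumes "fueled f (Suc n) F"
  shows "fueled (Mu f) n
    (\<lambda>w e. rec_nat 0 (\<lambda>k a. if a \<noteq> 0 then a else if F w (case_nat k e) = 0 then 1
        else if F w (case_nat k e) = 1 then k + 2 else 0) w - 1)"
  unfolding fueled_def
proof (intro conjI allI)
  have F: "computable_fun (Suc (Suc n)) (\<lambda>e. F (e 0) (\<lambda>i. e (Suc i)))"
    using assms by (simp add: fueled_def)
  have "computable_fun (Suc (Suc (Suc n))) (\<lambda>e. case_nat (e 0) (\<lambda>i. e (Suc (Suc (Suc i)))) i)"
    if "i < Suc n" for i
    using that by (auto simp: less_Suc_eq_0_disj intro!: computable_fun_proj)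
  note F = computable_fun_compose_Cons[OF F _ this]
  show "computable_fun (Suc n) (\<lambda>e. rec_nat 0 (\<lambda>k a. if a \<noteq> 0 then a
        else if F (e 0) (case_nat k (\<lambda>i. e (Suc i))) = 0 then 1
        else if F (e 0) (case_nat k (\<lambda>i. e (Suc i))) = 1 then k + 2 else 0) (e 0) - 1)"
    by (intro computable_fun_diff computable_fun_rec_nat computable_fun_if decidable_not decidable_eq
          computable_fun_const computable_fun_add computable_fun_proj F) auto
next
  fix e :: "nat \<Rightarrow> nat"
  let ?xs = "map e [0..<n]"
  define A where "A w c = rec_nat 0 (\<lambda>k a. if a \<noteq> 0 then a else if F w (case_nat k e) = 0 then 1
        else if F w (case_nat k e) = 1 then k + 2 else 0) c" for w c
  have F: "approximates (\<lambda>w. F w (case_nat k e)) (computes f (k # ?xs))" for k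
    using assms[unfolded fueled_def, THEN conjunct2, rule_format, of "case_nat k e"]
    by (simp add: map_upt_Suc_conv del: upt_Suc)
  have A0: "A w c = 0 \<Longrightarrow> k < c \<Longrightarrow> F w (case_nat k e) > 1" for w c k
    by (induction c) (auto simp: A_def less_Suc_eq split: if_splits)
  have A_found: "A w c = k + 2 \<Longrightarrow> F w (case_nat k e) = 1 \<and> (\<forall>i<k. F w (case_nat i e) > 1)" for w c k
  proof (induction c)
    case (Suc c)
    then show ?case using A0[of w c] by (auto simp: A_def split: if_splits)
  qed (simp add: A_def)
  have A_searching: "(\<And>i. i < c \<Longrightarrow> F w (case_nat i e) > 1) \<Longrightarrow> A w c = 0" for w c
  proof (induction c)
    case (Suc c)
    have "A w c = 0" by (rule Suc.IH) (rule Suc.prems, simp)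
    moreover have "F w (case_nat c e) > 1" by (rule Suc.prems) simp
    ultimately show ?case by (simp add: A_def)
  qed (simp add: A_def)
  have A_stays: "A w c = k + 2 \<Longrightarrow> A w (c + d) = k + 2" for w c d k
    by (induction d) (auto simp: A_def)
  \<comment> \<open>Subtracting 1 sends both failure states \<open>0\<close> and \<open>1\<close> to
    \<open>0\<close>, and the success state \<open>k + 2\<close> to \<open>Suc k\<close>.\<close>
  have "approximates (\<lambda>w. A w w - 1) (computes (Mu f) ?xs)"
  proof (rule approximatesI)
    fix w k
    assume "A w w - 1 = Suc k"
    then have "A w w = k + 2" by simp
    note found = A_found[OF this]
    have "computes f (k # ?xs) 0"
      using found by (intro approximatesD(1)[OF F, of w]) simp
    moreover have "\<exists>y. computes f (i # ?xs) (Suc y)" if "i < k" for i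
    proof -
      have "F w (case_nat i e) = Suc (Suc (F w (case_nat i e) - 2))"
        using found that by (auto simp: Suc_diff_Suc numeral_2_eq_2)
      then show ?thesis using approximatesD(1)[OF F] by blast
    qed
    ultimately show "computes (Mu f) ?xs k" by (blast intro: computes.mu)
  next
    fix k
    assume "computes (Mu f) ?xs k"
    then obtain y where "computes f (k # ?xs) 0" and y: "\<And>i. i < k \<Longrightarrow> computes f (i # ?xs) (Suc (y i))"
      by (elim computes_MuE) metis
    then have "eventually (\<lambda>w. F w (case_nat k e) = 1) sequentially"
      using approximatesD(2)[OF F, of k 0] by simp
    moreover have "eventually (\<lambda>w. \<forall>i\<in>{..<k}. F w (case_nat i e) = Suc (Suc (y i))) sequentially"
      using approximatesD(2)[OF F y] by (intro eventually_ball_finite) auto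
    \<comment> \<open>The fuel is also the length of the scan, so it must exceed \<open>k\<close>
      for the argument \<open>k\<close> to be reached.\<close>
    ultimately show "eventually (\<lambda>w. A w w - 1 = Suc k) sequentially"
      using eventually_gt_at_top[of k]
    proof eventually_elim
      case (elim w)
      then have "A w k = 0" by (intro A_searching) auto
      moreover have "F w (case_nat k e) = 1" by (rule elim)
      ultimately have "A w (Suc k) = k + 2" by (simp add: A_def)
      from A_stays[OF this, of "w - Suc k"] \<open>k < w\<close> show ?case by simp
    qed
  qed
  then show "approximates (\<lambda>w. rec_nat 0 (\<lambda>k a. if a \<noteq> 0 then a else if F w (case_nat k e) = 0 then 1
        else if F w (case_nat k e) = 1 then k + 2 else 0) w - 1) (computes (Mu f) ?xs)"
    unfolding A_def .
qed

text \<open>Structural induction with the arity arbitrary, since \<open>Comp\<close>,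
  \<open>Prec\<close> and \<open>Mu\<close> evaluate their subprograms at other arities. Programs of
  the wrong arity diverge and get the constant \<open>0\<close>.\<close>

lemma fueled_exists: "\<exists>E. fueled p n E"
proof (induction p arbitrary: n)
  case Zero
  have "computes Zero xs y \<longleftrightarrow> y = 0" for xs y
    by (auto intro: computes.zero elim: computes_ZeroE)
  then show ?case using fueled_total[OF computable_fun_const[of n 0], of Zero] by blast
next
  case Succ
  have iff: "computes Succ xs y \<longleftrightarrow> (\<exists>x. xs = [x] \<and> y = Suc x)" for xs y
    by (auto intro: computes.succ elim: computes_SuccE)
  show ?case
  proof (cases "n = 1")
    case True
    have "computable_fun 1 (\<lambda>e. Suc (e 0))" by (intro computable_intros) simp
    from fueled_total[OF this, of Succ] True show ?thesis by (auto simp: iff)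
  next
    case False
    then have "\<not> computes Succ (map e [0..<n]) y" for e y
      unfolding iff by (metis One_nat_def length_Cons length_map length_upt list.size(3) minus_nat.diff_0)
    then show ?thesis by (blast intro: fueled_diverging)
  qed
next
  case (Proj i)
  have iff: "computes (Proj i) xs y \<longleftrightarrow> i < length xs \<and> y = xs ! i" for xs y
    by (auto intro: computes.proj elim: computes_ProjE)
  show ?case
  proof (cases "i < n")
    case True
    with fueled_total[OF computable_fun_proj[OF True], of "Proj i"] show ?thesis by (auto simp: iff)
  next
    case False
    then have "\<not> computes (Proj i) (map e [0..<n]) y" for e y by (simp add: iff)
    then show ?thesis by (blast intro: fueled_diverging)
  qed
next
  case (Comp f gs)
  obtain F where F: "fueled f (length gs) F" using Comp.IH(1) by blast
  have G: "fueled (gs ! i) n (SOME E. fueled (gs ! i) n E)" if "i < length gs" for i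
    using Comp.IH(2)[OF nth_mem[OF that]] by (rule someI_ex)
  show ?case using fueled_Comp[OF F G] by blast
next
  case (Prec f g)
  show ?case
  proof (cases n)
    case 0
    have "\<not> computes (Prec f g) [] y" for y by (auto elim: computes.cases)
    then have "fueled (Prec f g) 0 (\<lambda>_ _. 0)" by (intro fueled_diverging) simp
    with 0 show ?thesis by blast
  next
    case (Suc m)
    obtain F G where "fueled f m F" "fueled g (Suc (Suc m)) G" using Prec.IH by blast
    from fueled_Prec[OF this] show ?thesis unfolding Suc by (rule exI[where P = "fueled (Prec f g) (Suc m)"])
  qed
next
  case (Mu f)
  obtain F where "fueled f (Suc n) F" using Mu.IH by blast
  from fueled_Mu[OF this] show ?case by (rule exI[where P = "fueled (Mu f) n"])
qed

text \<open>The fuel is the witness, so the graph of a partial program is a projection of a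
  decidable relation.\<close>

lemma semidecidable_computes:
  assumes "\<forall>A\<in>set As. computable_fun n A" "computable_fun n B"
  shows "semidecidable n (\<lambda>e. computes p (map (\<lambda>A. A e) As) (B e))"
proof -
  let ?k = "length As"
  obtain E where E: "fueled p ?k E" using fueled_exists by blast
  have "decidable (Suc (Suc ?k)) (\<lambda>e. E (e 0) (\<lambda>i. e (Suc (Suc i))) = Suc (e 1))"
    by (intro decidable_eq computable_fun_Suc
        computable_fun_compose_Cons[OF E[unfolded fueled_def, THEN conjunct1]] computable_fun_proj) auto
  moreover have "computes p (map (\<lambda>i. e (Suc i)) [0..<?k]) (e 0) \<longleftrightarrow> (\<exists>w. E w (\<lambda>i. e (Suc i)) = Suc (e 0))" for e
    using E unfolding fueled_def approximates_def by (meson eventually_happens' sequentially_bot)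
  ultimately have computes: "semidecidable (Suc ?k) (\<lambda>e. computes p (map (\<lambda>i. e (Suc i)) [0..<?k]) (e 0))"
    unfolding semidecidable_def by (intro exI[of _ "\<lambda>w e. E w (\<lambda>i. e (Suc i)) = Suc (e 0)"]) simp
  have "semidecidable n (\<lambda>e. (\<lambda>e. computes p (map (\<lambda>i. e (Suc i)) [0..<?k]) (e 0))
      (\<lambda>i. case_nat B ((!) As) i e))"
    by (rule semidecidable_compose[OF computes]) (use assms in \<open>auto simp: less_Suc_eq_0_disj\<close>)
  then have "semidecidable n (\<lambda>e. computes p (map (\<lambda>i. (As ! i) e) [0..<?k]) (B e))"
    by simp
  moreover have "map (\<lambda>i. (As ! i) e) [0..<?k] = map (\<lambda>A. A e) As" for e
    by (rule nth_equalityI) auto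
  ultimately show ?thesis by simp
qed

lemma semidecidable_mem_enumerated:
  assumes "computable_fun n A" "computable_fun n B"
  shows "semidecidable n (\<lambda>e. B e \<in> enumerated p (A e))"
proof -
  have "semidecidable (Suc n) (\<lambda>e. computes p [A (\<lambda>i. e (Suc i)), e 0] (B (\<lambda>i. e (Suc i))))"
    using semidecidable_computes[of "[\<lambda>e. A (\<lambda>i. e (Suc i)), \<lambda>e. e 0]" "Suc n" "\<lambda>e. B (\<lambda>i. e (Suc i))" p]
    by (simp add: computable_fun_shift computable_fun_proj assms)
  then show ?thesis
    unfolding enumerated_def mem_Collect_eq by (rule semidecidable_ex)
qed

lemma semidecidable_halts_on:
  assumes "computable_fun n A"
  shows "semidecidable n (\<lambda>e. halts_on p [A e])"
proof -
  have "semidecidable (Suc n) (\<lambda>e. computes p [A (\<lambda>i. e (Suc i))] (e 0))"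
    using semidecidable_computes[of "[\<lambda>e. A (\<lambda>i. e (Suc i))]" "Suc n" "\<lambda>e. e 0" p]
    by (simp add: computable_fun_shift computable_fun_proj assms)
  then show ?thesis
    unfolding halts_on_def by (rule semidecidable_ex)
qed

section \<open>Recursively compact sets\<close>

definition ball_center :: "nat \<Rightarrow> nat" where
  "ball_center b = fst (prod_decode b)"

definition ball_radius :: "nat \<Rightarrow> real" where
  "ball_radius b = real (Suc (fst (prod_decode (snd (prod_decode b)))))
     / real (Suc (snd (prod_decode (snd (prod_decode b)))))"

lemma basic_ball_eq: "basic_ball s b = ball (s (ball_center b)) (ball_radius b)"
  by (simp add: basic_ball_def ball_center_def ball_radius_def split: prod.split)

lemma small_basic_ball:
  assumes "closure (range s) = UNIV" "\<epsilon> > 0"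
  obtains b where "y \<in> basic_ball s b" "ball_radius b < \<epsilon>"
proof -
  obtain N where N: "1 / real (Suc N) < \<epsilon>"
    using nat_approx_posE[OF assms(2)] by auto
  obtain i where i: "dist (s i) y < 1 / real (Suc N)"
    using assms(1) closure_approachable[of y "range s"]
    by (metis UNIV_I of_nat_0_less_iff rangeE zero_less_Suc zero_less_divide_1_iff)
  \<comment> \<open>The code \<open>0\<close> stands for the numerator 1, and \<open>N\<close> for
    the denominator \<open>N + 1\<close>.\<close>
  define b where "b = prod_encode (i, prod_encode (0, N))"
  have "ball_center b = i" "ball_radius b = 1 / real (Suc N)"
    by (simp_all add: b_def ball_center_def ball_radius_def)
  then show ?thesis
    using N i by (intro that[of b]) (simp_all add: basic_ball_eq)
qed

text \<open>Makes quantifiers over a coded finite set bounded by its code.\<close>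

lemma mem_set_decode_less: "j \<in> set_decode c \<Longrightarrow> j < c"
proof -
  assume "j \<in> set_decode c"
  then have "c div 2 ^ j \<noteq> 0" unfolding set_decode_def by (auto elim: oddE)
  then have "2 ^ j \<le> c" by (simp add: div_eq_0_iff)
  then show "j < c" using less_exp[of j] by linarith
qed

text \<open>By compactness a cover has a finite subcover, so one searches for a code
  \<open>c\<close> of a finite set of indices satisfying \<open>Q\<close> on which the algorithm for
  \<open>K\<close> halts. It is enough that \<open>Q\<close> is semidecidable, because only finitely
  many indices have to be verified.\<close>

lemma semidecidable_subset_basic_union:
  assumes "recursively_compact s K" "semidecidable (Suc n) (\<lambda>e. Q (e 0) (\<lambda>i. e (Suc i)))"
  shows "semidecidable n (\<lambda>e. K \<subseteq> basic_union s {j. Q j e})"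
proof -
  obtain p where K: "compact K"
    and p: "\<And>I. finite I \<Longrightarrow> halts_on p [set_encode I] \<longleftrightarrow> K \<subseteq> basic_union s I"
    using assms(1) unfolding recursively_compact_def by blast
  have "K \<subseteq> basic_union s J \<longleftrightarrow> (\<exists>c. (\<forall>j<c. j \<notin> set_decode c \<or> j \<in> J) \<and> halts_on p [c])" for J
  proof
    assume "K \<subseteq> basic_union s J"
    then have "K \<subseteq> (\<Union>j\<in>J. basic_ball s j)" by (simp add: basic_union_def)
    then obtain I where I: "I \<subseteq> J" "finite I" "K \<subseteq> (\<Union>j\<in>I. basic_ball s j)"
      using K by (elim compactE_image[of K J "basic_ball s"]) (auto simp: basic_ball_eq)
    then have "halts_on p [set_encode I]" by (simp add: p basic_union_def)
    with I show "\<exists>c. (\<forall>j<c. j \<notin> set_decode c \<or> j \<in> J) \<and> halts_on p [c]"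
      by (intro exI[of _ "set_encode I"]) auto
  next
    assume "\<exists>c. (\<forall>j<c. j \<notin> set_decode c \<or> j \<in> J) \<and> halts_on p [c]"
    then obtain c where c: "\<And>j. j < c \<Longrightarrow> j \<notin> set_decode c \<or> j \<in> J" "halts_on p [c]" by blast
    then have "set_decode c \<subseteq> J" using mem_set_decode_less by blast
    moreover have "K \<subseteq> basic_union s (set_decode c)"
      using c(2) p[of "set_decode c"] by simp
    ultimately show "K \<subseteq> basic_union s J" unfolding basic_union_def by blast
  qed
  moreover have "semidecidable n (\<lambda>e. \<exists>c. (\<forall>j<c. j \<notin> set_decode c \<or> Q j e) \<and> halts_on p [c])"
    by (intro semidecidable_ex semidecidable_conj semidecidable_ball semidecidable_disj semidecidable_halts_on
        semidecidable_decidable decidable_not decidable_mem_set_decode computable_fun_proj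
        semidecidable_compose_Cons[OF assms(2)]) auto
  ultimately show ?thesis by simp
qed

section \<open>Comparison of distances with rationals\<close>

text \<open>An even code \<open>2 * k\<close> stands for the integer \<open>k\<close>, an odd code
  \<open>2 * k + 1\<close> for \<open>- (k + 1)\<close>. A quotient exceeding a nonnegative rational
  has numerator and denominator of equal sign, and a quotient with denominator 0 is 0. What remains
  is an inequality of naturals, hence decidable.\<close>

lemma less_nat_to_rat_surj_iff:
  assumes "v > 0"
  shows "real u / real v < real_of_rat (nat_to_rat_surj r) \<longleftrightarrow>
    (let a = fst (prod_decode r); b = snd (prod_decode r) in
      even a \<and> even b \<and> 0 < b div 2 \<and> u * (b div 2) < v * (a div 2) \<or>
      odd a \<and> odd b \<and> u * Suc (b div 2) < v * Suc (a div 2))"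
proof -
  obtain a b where r: "r = prod_encode (a, b)"
    by (metis prod_decode_inverse surj_pair)
  have int_decode: "int_decode n = (if even n then int (n div 2) else - int (Suc (n div 2)))" for n
    by (simp add: int_decode_def sum_decode_def)
  have rat: "real_of_rat (nat_to_rat_surj (prod_encode (a, b))) = real_of_int (int_decode a) / real_of_int (int_decode b)"
    by (simp add: nat_to_rat_surj_def of_rat_rat Fract_of_int_quotient of_rat_divide)
  have pos: "real u / real v < real c / real d \<longleftrightarrow> u * d < v * c" if "d > 0" for c d
  proof -
    have "real u / real v < real c / real d \<longleftrightarrow> real (u * d) < real (v * c)"
      using assms that by (simp add: field_simps)
    then show ?thesis by (simp only: of_nat_less_iff)
  qed
  have neg: "\<not> real u / real v < - (real c / real d)" for c d
    by (smt (verit) divide_nonneg_nonneg of_nat_0_le_iff)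
  consider "even a" "even b" | "even a" "odd b" | "odd a" "even b" | "odd a" "odd b" by blast
  then show ?thesis
  proof cases
    case 1
    have "\<not> real u / real v < 0" by (simp add: not_less)
    with 1 show ?thesis
      using pos[of "b div 2" "a div 2"] by (cases "b div 2 = 0") (auto simp: r rat int_decode)
  next
    case 2
    with neg[of "a div 2" "Suc (b div 2)"] show ?thesis
      by (simp add: r rat int_decode del: of_nat_Suc)
  next
    case 3
    with neg[of "Suc (a div 2)" "b div 2"] show ?thesis
      by (simp add: r rat int_decode del: of_nat_Suc)
  next
    case 4
    with pos[of "Suc (b div 2)" "Suc (a div 2)"] show ?thesis
      by (simp add: r rat int_decode del: of_nat_Suc)
  qed
qed

text \<open>A strict inequality is certified by an approximation of precision
  \<open>1 / 2 ^ k\<close> that exceeds the bound by more than \<open>1 / 2 ^ k\<close>.\<close>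

lemma semidecidable_less_dist:
  assumes "computable_metric_space t"
    and "computable_fun n A" "computable_fun n B" "computable_fun n U" "computable_fun n V"
    and "\<And>e. V e > 0"
  shows "semidecidable n (\<lambda>e. real (U e) / real (V e) < dist (t (A e)) (t (B e)))"
proof -
  obtain p where p: "\<And>i j k. \<exists>r. computes p [i, j, k] r \<and>
      \<bar>dist (t i) (t j) - real_of_rat (nat_to_rat_surj r)\<bar> \<le> 1 / 2 ^ k"
    using assms(1) unfolding computable_metric_space_def by blast
  have "real u / real v < dist (t i) (t j) \<longleftrightarrow>
     (\<exists>k r. computes p [i, j, k] r \<and> real (u * 2 ^ k + v) / real (v * 2 ^ k) < real_of_rat (nat_to_rat_surj r))"
    (is "?l \<longleftrightarrow> ?r") if "v > 0" for i j u v
  proof -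
    have sum: "real (u * 2 ^ k + v) / real (v * 2 ^ k) = real u / real v + 1 / 2 ^ k" for k
      using that by (simp add: field_simps)
    show ?thesis
    proof
      assume ?l
      then have "(dist (t i) (t j) - real u / real v) / 2 > 0" by simp
      \<comment> \<open>Half of the gap, because the error of the approximation and the required
        margin are both \<open>1 / 2 ^ k\<close>.\<close>
      then obtain k where k: "(1 / 2) ^ k < (dist (t i) (t j) - real u / real v) / 2"
        using real_arch_pow_inv[of "(dist (t i) (t j) - real u / real v) / 2" "1 / 2"] by auto
      obtain r where "computes p [i, j, k] r"
          "\<bar>dist (t i) (t j) - real_of_rat (nat_to_rat_surj r)\<bar> \<le> 1 / 2 ^ k"
        using p by blast
      with k show ?r
        unfolding sum by (intro exI[of _ k] exI[of _ r]) (auto simp: power_one_over abs_le_iff field_simps)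
    next
      assume ?r
      then obtain k r where kr: "computes p [i, j, k] r" "real u / real v + 1 / 2 ^ k < real_of_rat (nat_to_rat_surj r)"
        unfolding sum by blast
      \<comment> \<open>By determinism the output \<open>r\<close> found in the search is the
        accurate one.\<close>
      moreover have "\<bar>dist (t i) (t j) - real_of_rat (nat_to_rat_surj r)\<bar> \<le> 1 / 2 ^ k"
        using p[of i j k] kr(1) computes_deterministic by blast
      ultimately show ?l by linarith
    qed
  qed
  moreover have "semidecidable n (\<lambda>e. \<exists>k r. computes p [A e, B e, k] r \<and>
      real (U e * 2 ^ k + V e) / real (V e * 2 ^ k) < real_of_rat (nat_to_rat_surj r))"
  proof (intro semidecidable_ex semidecidable_conj)
    note shift = computable_fun_shift[OF computable_fun_shift] assms(2-5)
    show "semidecidable (Suc (Suc n)) (\<lambda>e. computes p [A (\<lambda>i. e (Suc (Suc i))), B (\<lambda>i. e (Suc (Suc i))), e (Suc 0)] (e 0))"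
      using semidecidable_computes[of "[\<lambda>e. A (\<lambda>i. e (Suc (Suc i))), \<lambda>e. B (\<lambda>i. e (Suc (Suc i))), \<lambda>e. e (Suc 0)]"
          "Suc (Suc n)" "\<lambda>e. e 0" p]
      by (simp add: shift computable_fun_proj)
    have pos: "0 < V e * 2 ^ k" for e k using assms(6) by simp
    show "semidecidable (Suc (Suc n)) (\<lambda>e. real (U (\<lambda>i. e (Suc (Suc i))) * 2 ^ e (Suc 0) + V (\<lambda>i. e (Suc (Suc i))))
        / real (V (\<lambda>i. e (Suc (Suc i))) * 2 ^ e (Suc 0)) < real_of_rat (nat_to_rat_surj (e 0)))"
      unfolding less_nat_to_rat_surj_iff[OF pos] Let_def
      by (intro semidecidable_decidable computable_intros shift) simp_all
  qed
  ultimately show ?thesis using assms(6) by simp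
qed

section \<open>Exteriors of closed balls\<close>

text \<open>A condition on centers and radii that forces the balls to be disjoint and, unlike a
  statement about points, is a strict inequality for the distance of two special points.\<close>

definition apart_balls :: "(nat \<Rightarrow> 'a::metric_space) \<Rightarrow> nat \<Rightarrow> nat \<Rightarrow> bool" where
  "apart_balls t b c \<longleftrightarrow> ball_radius b + ball_radius c < dist (t (ball_center b)) (t (ball_center c))"

lemma semidecidable_apart_balls:
  assumes "computable_metric_space t" "computable_fun n A" "computable_fun n B"
  shows "semidecidable n (\<lambda>e. apart_balls t (A e) (B e))"
proof -
  have sum: "real (Suc a) / real (Suc b) + real (Suc c) / real (Suc d)
      = real (Suc a * Suc d + Suc c * Suc b) / real (Suc b * Suc d)" for a b c d
    unfolding of_nat_add of_nat_mult by (rule add_frac_eq) simp_all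
  show ?thesis
    unfolding apart_balls_def ball_radius_def ball_center_def sum
    by (intro semidecidable_less_dist[OF assms(1)] computable_intros assms(2,3)) simp_all
qed

lemma basic_union_apart_balls:
  assumes "closure (range t) = UNIV"
  shows "basic_union t {c. apart_balls t b c} = - cball (t (ball_center b)) (ball_radius b)"
proof (intro equalityI subsetI)
  fix y
  assume "y \<in> basic_union t {c. apart_balls t b c}"
  then obtain c where "apart_balls t b c" "dist (t (ball_center c)) y < ball_radius c"
    by (auto simp: basic_union_def basic_ball_eq)
  then show "y \<in> - cball (t (ball_center b)) (ball_radius b)"
    using dist_triangle2[of "t (ball_center b)" "t (ball_center c)" y] by (simp add: apart_balls_def)
next
  fix y
  assume "y \<in> - cball (t (ball_center b)) (ball_radius b)"
  \<comment> \<open>Half of the gap, because the radius of \<open>c\<close> is lost twice: from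
    \<open>y\<close> to the center of \<open>c\<close>, and as a summand in
    \<open>apart_balls\<close>.\<close>
  then have "(dist (t (ball_center b)) y - ball_radius b) / 2 > 0" by simp
  then obtain c where c: "y \<in> basic_ball t c" "ball_radius c < (dist (t (ball_center b)) y - ball_radius b) / 2"
    using small_basic_ball[OF assms] by blast
  then have "apart_balls t b c"
    using dist_triangle[of "t (ball_center b)" y "t (ball_center c)"]
    by (simp add: apart_balls_def basic_ball_eq)
  with c(1) show "y \<in> basic_union t {c. apart_balls t b c}"
    by (auto simp: basic_union_def)
qed

section \<open>Computable maps on recursively compact sets\<close>

text \<open>Stated with an explicit index set, which is semidecidable whenever membership in
  \<open>J\<close> is.\<close>

lemma vimage_basic_union:
  assumes "\<And>m. {x \<in> Z. f x \<in> basic_ball t m} = basic_union s (enumerated p m) \<inter> Z"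
  shows "{x \<in> Z. f x \<in> basic_union t J} = basic_union s {j. \<exists>m. m \<in> J \<and> j \<in> enumerated p m} \<inter> Z"
proof -
  have "{x \<in> Z. f x \<in> basic_union t J} = (\<Union>m\<in>J. {x \<in> Z. f x \<in> basic_ball t m})"
    by (auto simp: basic_union_def)
  also have "\<dots> = basic_union s {j. \<exists>m. m \<in> J \<and> j \<in> enumerated p m} \<inter> Z"
    unfolding assms by (auto simp: basic_union_def)
  finally show ?thesis .
qed

theorem recursively_compact_image:
  assumes "recursively_compact s K" "continuous_on K f" "computable_map s t K f"
  shows "recursively_compact t (f ` K)"
proof -
  obtain p where p: "\<And>m. {x \<in> K. f x \<in> basic_ball t m} = basic_union s (enumerated p m) \<inter> K"
    using assms(3) unfolding computable_map_def by blast
  have "semidecidable 1 (\<lambda>e. K \<subseteq> basic_union s {j. \<exists>m. m \<in> set_decode (e 0) \<and> j \<in> enumerated p m})"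
    by (intro semidecidable_subset_basic_union[OF assms(1)] semidecidable_ex semidecidable_conj
        semidecidable_mem_enumerated semidecidable_decidable decidable_mem_set_decode computable_fun_proj) auto
  then obtain q where q: "\<And>c. halts_on q [c] \<longleftrightarrow>
      K \<subseteq> basic_union s {j. \<exists>m. m \<in> set_decode c \<and> j \<in> enumerated p m}"
    using semidecidable_halts[of "\<lambda>c. K \<subseteq> basic_union s {j. \<exists>m. m \<in> set_decode c \<and> j \<in> enumerated p m}"]
    by blast
  have "halts_on q [set_encode I] \<longleftrightarrow> f ` K \<subseteq> basic_union t I" if "finite I" for I
  proof -
    have "f ` K \<subseteq> basic_union t I \<longleftrightarrow> K \<subseteq> {x \<in> K. f x \<in> basic_union t I}" by blast
    also have "\<dots> \<longleftrightarrow> halts_on q [set_encode I]"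
      unfolding vimage_basic_union[OF p] q using that by simp
    finally show ?thesis by simp
  qed
  moreover have "compact (f ` K)"
    using assms(1,2) by (auto simp: recursively_compact_def intro: compact_continuous_image)
  ultimately show ?thesis unfolding recursively_compact_def by blast
qed

lemma computable_map_compose:
  assumes "computable_map s t Z f" "computable_map t u W g" "f ` Z \<subseteq> W"
  shows "computable_map s u Z (g \<circ> f)"
proof -
  obtain p where p: "\<And>m. {x \<in> Z. f x \<in> basic_ball t m} = basic_union s (enumerated p m) \<inter> Z"
    using assms(1) unfolding computable_map_def by blast
  obtain q where q: "\<And>m. {y \<in> W. g y \<in> basic_ball u m} = basic_union t (enumerated q m) \<inter> W"
    using assms(2) unfolding computable_map_def by blast
  have "semidecidable 2 (\<lambda>e. \<exists>n. n \<in> enumerated q (e 0) \<and> e 1 \<in> enumerated p n)"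
    by (intro semidecidable_ex semidecidable_conj semidecidable_mem_enumerated computable_fun_proj) auto
  then obtain r where r: "\<And>m. enumerated r m = {j. \<exists>n. n \<in> enumerated q m \<and> j \<in> enumerated p n}"
    using semidecidable_enumerated[of "\<lambda>m j. \<exists>n. n \<in> enumerated q m \<and> j \<in> enumerated p n"] by blast
  have "{x \<in> Z. (g \<circ> f) x \<in> basic_ball u m} = basic_union s (enumerated r m) \<inter> Z" for m
  proof -
    have "{x \<in> Z. (g \<circ> f) x \<in> basic_ball u m} = {x \<in> Z. f x \<in> basic_union t (enumerated q m)}"
      using assms(3) q[of m] by auto
    then show ?thesis unfolding vimage_basic_union[OF p] r .
  qed
  then show ?thesis unfolding computable_map_def by blast
qed

theorem computable_map_descend:
  assumes "recursively_compact s K" "computable_metric_space t"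
    and "computable_map s t K f" "computable_map s u K (g \<circ> f)" "continuous_on (f ` K) g"
  shows "computable_map t u (f ` K) g"
proof -
  have dense: "closure (range t) = UNIV"
    using assms(2) by (simp add: computable_metric_space_def)
  obtain p where p: "\<And>m. {x \<in> K. f x \<in> basic_ball t m} = basic_union s (enumerated p m) \<inter> K"
    using assms(3) unfolding computable_map_def by blast
  obtain q where q: "\<And>m. {x \<in> K. (g \<circ> f) x \<in> basic_ball u m} = basic_union s (enumerated q m) \<inter> K"
    using assms(4) unfolding computable_map_def by blast
  \<comment> \<open>Indices of the balls that cover, within \<open>K\<close>, the preimage of ball
    \<open>m\<close> under the composite and the preimage under \<open>f\<close> of the exterior of
    the closed ball \<open>b\<close>.\<close>
  define Q where "Q m b j \<longleftrightarrow> j \<in> enumerated q m \<or> (\<exists>c. apart_balls t b c \<and> j \<in> enumerated p c)" for m b j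
  have "semidecidable 2 (\<lambda>e. K \<subseteq> basic_union s {j. Q (e 0) (e 1) j})"
    unfolding Q_def
    by (intro semidecidable_subset_basic_union[OF assms(1)] semidecidable_disj semidecidable_ex semidecidable_conj
        semidecidable_mem_enumerated semidecidable_apart_balls[OF assms(2)] computable_fun_proj) auto
  then obtain r where r: "\<And>m. enumerated r m = {b. K \<subseteq> basic_union s {j. Q m b j}}"
    using semidecidable_enumerated[of "\<lambda>m b. K \<subseteq> basic_union s {j. Q m b j}"] by blast
  have cover: "K \<subseteq> basic_union s {j. Q m b j} \<longleftrightarrow>
      (\<forall>y\<in>f ` K. y \<in> cball (t (ball_center b)) (ball_radius b) \<longrightarrow> g y \<in> basic_ball u m)" for m b
  proof -
    have "basic_union s {j. Q m b j} \<inter> K = (basic_union s (enumerated q m) \<inter> K) \<union>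
        (basic_union s {j. \<exists>c. c \<in> {c. apart_balls t b c} \<and> j \<in> enumerated p c} \<inter> K)"
      by (auto simp: basic_union_def Q_def)
    also have "\<dots> = {x \<in> K. (g \<circ> f) x \<in> basic_ball u m} \<union>
        {x \<in> K. f x \<in> - cball (t (ball_center b)) (ball_radius b)}"
      unfolding vimage_basic_union[OF p, symmetric] q basic_union_apart_balls[OF dense] ..
    finally show ?thesis by auto
  qed
  have "{y \<in> f ` K. g y \<in> basic_ball u m} = basic_union t (enumerated r m) \<inter> f ` K" for m
  proof (intro equalityI subsetI)
    fix y
    \<comment> \<open>Continuity of \<open>g\<close> at \<open>y\<close> is used to find a closed
      ball around \<open>y\<close> whose trace on the image is mapped into ball
      \<open>m\<close>.\<close>
    assume y: "y \<in> {y \<in> f ` K. g y \<in> basic_ball u m}"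
    then obtain \<epsilon> where \<epsilon>: "\<epsilon> > 0" "\<And>z. z \<in> f ` K \<Longrightarrow> dist z y < \<epsilon> \<Longrightarrow> g z \<in> basic_ball u m"
    proof -
      have "open (basic_ball u m)" by (simp add: basic_ball_eq)
      then obtain A where "open A" "y \<in> A" "\<And>z. z \<in> f ` K \<Longrightarrow> z \<in> A \<Longrightarrow> g z \<in> basic_ball u m"
        using assms(5)[unfolded continuous_on_topological, rule_format, of y "basic_ball u m"] y by blast
      moreover from this obtain \<epsilon> where "\<epsilon> > 0" "\<And>z. dist z y < \<epsilon> \<Longrightarrow> z \<in> A"
        unfolding open_dist by blast
      ultimately show ?thesis by (intro that[of \<epsilon>]) simp_all
    qed
    obtain b where b: "y \<in> basic_ball t b" "ball_radius b < \<epsilon> / 2"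
      using small_basic_ball[OF dense, of "\<epsilon> / 2"] \<epsilon>(1) by auto
    \<comment> \<open>Both \<open>y\<close> and \<open>z\<close> lie within the radius of
      \<open>b\<close> from its center, so their distance is below twice that radius and hence below
      \<epsilon>.\<close>
    have "g z \<in> basic_ball u m" if "z \<in> f ` K" "z \<in> cball (t (ball_center b)) (ball_radius b)" for z
      using that b dist_triangle3[of z y "t (ball_center b)"]
      by (intro \<epsilon>(2)) (auto simp: basic_ball_eq)
    then have "b \<in> enumerated r m" by (simp add: r cover)
    with b(1) y show "y \<in> basic_union t (enumerated r m) \<inter> f ` K"
      by (auto simp: basic_union_def)
  next
    fix y
    assume "y \<in> basic_union t (enumerated r m) \<inter> f ` K"
    then obtain b where "b \<in> enumerated r m" "y \<in> basic_ball t b" "y \<in> f ` K"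
      by (auto simp: basic_union_def)
    then show "y \<in> {y \<in> f ` K. g y \<in> basic_ball u m}"
      by (auto simp: r cover basic_ball_eq)
  qed
  then show ?thesis unfolding computable_map_def by blast
qed

section \<open>The factor action\<close>

theorem proposition3p30:
  fixes \<Gamma> :: "('g, 'r) monoid_scheme"
    and s :: "nat \<Rightarrow> 'a::metric_space" and t :: "nat \<Rightarrow> 'b::metric_space"
    and X' :: "'a set" and Y' :: "'b set"
    and \<phi> :: "'g \<Rightarrow> 'a \<Rightarrow> 'a" and \<psi> :: "'g \<Rightarrow> 'b \<Rightarrow> 'b"
    and f :: "'a \<Rightarrow> 'b"
  assumes "finitely_generated_group \<Gamma>"
    and "computable_metric_space s"
    and "computable_metric_space t"
    and "recursively_compact s X'"
    and "computable_action \<Gamma> s X' \<phi>"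
    and "action_by_homeomorphisms \<Gamma> Y' \<psi>"
    and "topological_factor_map \<Gamma> X' \<phi> Y' \<psi> f"
    and "computable_map s t X' f"
  shows "recursively_compact t Y' \<and> computable_action \<Gamma> t Y' \<psi>"
proof
  have f: "continuous_on X' f" "f ` X' = Y'"
    and equivariant: "\<And>g x. g \<in> carrier \<Gamma> \<Longrightarrow> x \<in> X' \<Longrightarrow> f (\<phi> g x) = \<psi> g (f x)"
    using assms(7) by (auto simp: topological_factor_map_def)
  show "recursively_compact t Y'"
    using recursively_compact_image[OF assms(4) f(1) assms(8)] f(2) by simp
  obtain S where S: "finite S" "S \<subseteq> carrier \<Gamma>" "generate \<Gamma> S = carrier \<Gamma>"
      "\<And>g. g \<in> S \<Longrightarrow> computable_map s s X' (\<phi> g)"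
    and homeo: "\<And>g. g \<in> carrier \<Gamma> \<Longrightarrow> \<exists>h. homeomorphism X' X' (\<phi> g) h"
    using assms(5) by (auto simp: computable_action_def action_by_homeomorphisms_def)
  \<comment> \<open>The generating set that witnesses computability upstairs serves for the factor
    as well.\<close>
  have "computable_map t t Y' (\<psi> g)" if "g \<in> S" for g
  proof -
    have g: "g \<in> carrier \<Gamma>" using that S(2) by blast
    have "\<phi> g ` X' \<subseteq> X'" using homeo[OF g] by (auto simp: homeomorphism_def)
    with S(4)[OF that] assms(8) have "computable_map s t X' (f \<circ> \<phi> g)"
      by (rule computable_map_compose)
    \<comment> \<open>Equivariance identifies the two composites on \<open>X'\<close> only, which is
      all that \<open>computable_map\<close> looks at.\<close>
    moreover have "{x \<in> X'. (f \<circ> \<phi> g) x \<in> B} = {x \<in> X'. (\<psi> g \<circ> f) x \<in> B}" for B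
      using equivariant[OF g] by auto
    ultimately have "computable_map s t X' (\<psi> g \<circ> f)" by (simp add: computable_map_def)
    moreover have "continuous_on (f ` X') (\<psi> g)"
      using assms(6) g f(2) by (auto simp: action_by_homeomorphisms_def homeomorphism_def)
    ultimately show ?thesis
      using computable_map_descend[OF assms(4,3,8)] f(2) by blast
  qed
  with S(1-3) assms(6) show "computable_action \<Gamma> t Y' \<psi>"
    unfolding computable_action_def by blast
qed

end
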